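(* Let $W$ be a finite reflection group acting on $V=\mathbb{R}^n$ and let $B$ be a fundamental chamber for $W$. Then the orbit realization space $\mathcal{R}_{\mathcal{O}}^W=\{\mathrm{conv}(W\cdot \mathbf{a}) : \mathbf{a}\in B\}$ is contractible and thus path-connected.
   Context: $W$ is a finite group generated by orthogonal reflections of Euclidean space $V=\mathbb{R}^n$, with root system $\Phi$. A chamber is a connected component of the complement in $V$ of the union of the hyperplanes $H_\alpha=\alpha^\perp$, $\alpha\in\Phi$; equivalently a set $\{c\in V : \langle c,\alpha\rangle>0 \text{ for all } \alpha\in\Phi_+\}$ for a positive system $\Phi_+\subset\Phi$. $B$ is one fixed (open) chamber. Topology on $\mathcal{R}_{\mathcal{O}}^W$: fix an ordering of $W$ with the identity first. The polytope $\mathrm{conv}(W\cdot\mathbf{a})$ ($\mathbf{a}\in B$) has vertices $w\cdot\mathbf{a}$ labeled bijectively by $w\in W$, and is identified with the $|W|\times n$ matrix whose $w$-th row is $w\cdot\mathbf{a}$. In this way $\mathcal{R}_{\mathcal{O}}^W\subseteq\mathbb{R}^{n\cdot|W|}$, and it carries the subspace topology. *)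

theory Defs
  imports
    "HOL-Analysis.Analysis"
    "HOL-Algebra.Bij"
    "HOL-Algebra.Generated_Groups"
begin

definition reflection :: "real ^ 'n \<Rightarrow> real ^ 'n \<Rightarrow> real ^ 'n" where
  "reflection \<alpha> x = x - (2 * (x \<bullet> \<alpha>) / (\<alpha> \<bullet> \<alpha>)) *\<^sub>R \<alpha>"

definition root_system :: "(real ^ 'n) set \<Rightarrow> bool" where
  "root_system \<Phi> \<longleftrightarrow>
     finite \<Phi> \<and> 0 \<notin> \<Phi> \<and>
     (\<forall>\<alpha>\<in>\<Phi>. \<Phi> \<inter> span {\<alpha>} = {\<alpha>, - \<alpha>}) \<and>
     (\<forall>\<alpha>\<in>\<Phi>. reflection \<alpha> ` \<Phi> = \<Phi>)"

text \<open>The empty root system (trivial group) is allowed, and \<open>\<Phi>\<close> need not span the space.\<close>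

definition finite_reflection_group :: "(real ^ 'n \<Rightarrow> real ^ 'n) set \<Rightarrow> (real ^ 'n) set \<Rightarrow> bool" where
  "finite_reflection_group W \<Phi> \<longleftrightarrow>
     root_system \<Phi> \<and> finite W \<and> W = generate (BijGroup UNIV) (reflection ` \<Phi>)"

definition chambers :: "(real ^ 'n) set \<Rightarrow> (real ^ 'n) set set" where
  "chambers \<Phi> = components (UNIV - (\<Union>\<alpha>\<in>\<Phi>. {x. x \<bullet> \<alpha> = 0}))"

definition orbit_polytope :: "(real ^ 'n \<Rightarrow> real ^ 'n) set \<Rightarrow> real ^ 'n \<Rightarrow> (real ^ 'n) set" where
  "orbit_polytope W a = convex hull ((\<lambda>w. w a) ` W)"

definition orbit_realizations ::
    "(real ^ 'n \<Rightarrow> real ^ 'n) set \<Rightarrow> (real ^ 'n) set \<Rightarrow> (real ^ 'n) set set" where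
  "orbit_realizations W B = {orbit_polytope W a | a. a \<in> B}"

text \<open>
  For a chamber \<open>B\<close> the base vertex is well defined: all points of an orbit lie on a sphere, so the
  vertices of \<open>orbit_polytope W a\<close> are exactly the points of the orbit of \<open>a\<close>, and \<open>a\<close> is the only
  one of them in \<open>B\<close>.
\<close>

definition base_vertex ::
    "(real ^ 'n \<Rightarrow> real ^ 'n) set \<Rightarrow> (real ^ 'n) set \<Rightarrow> (real ^ 'n) set \<Rightarrow> real ^ 'n" where
  "base_vertex W B P = (THE a. a \<in> B \<and> orbit_polytope W a = P)"

text \<open>
  The group elements are ordered by a list \<open>ws\<close>. A \<open>|W| \<times> n\<close> matrix is a function on
  \<open>{..<length ws} \<times> UNIV\<close> (extended by \<open>undefined\<close>, as for all points of a product topology);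
  its \<open>i\<close>-th row is the vertex labelled by \<open>ws ! i\<close>.
\<close>

definition vertex_matrix ::
    "(real ^ 'n \<Rightarrow> real ^ 'n) list \<Rightarrow> (real ^ 'n) set \<Rightarrow> (real ^ 'n) set \<Rightarrow> nat \<times> 'n \<Rightarrow> real" where
  "vertex_matrix ws B P =
     (\<lambda>(i, j)\<in>{..<length ws} \<times> UNIV. (ws ! i) (base_vertex (set ws) B P) $ j)"

text \<open>
  Since \<open>vertex_matrix ws B\<close> is injective on the realizations, the pullback topology is the
  subspace topology under the identification of polytopes with matrices.
\<close>

definition orbit_realization_space ::
    "(real ^ 'n \<Rightarrow> real ^ 'n) list \<Rightarrow> (real ^ 'n) set \<Rightarrow> (real ^ 'n) set topology" where
  "orbit_realization_space ws B =
     pullback_topology (orbit_realizations (set ws) B) (vertex_matrix ws B)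
       (powertop_real ({..<length ws} \<times> (UNIV :: 'n set)))"

end

theory Submission
  imports Defs
begin

text \<open>
  The chamber \<open>B\<close> is an intersection of open half-spaces, hence convex and contractible. The proof
  shows that \<open>a \<mapsto> conv (W a)\<close> is a homeomorphism from \<open>B\<close> onto the realization space. In
  coordinates this map sends \<open>a\<close> to the matrix with rows \<open>w a\<close>, which is linear in \<open>a\<close>; its inverse
  reads off the row labelled by the identity. So the one substantial point is that the map is
  injective, that is, that a polytope determines its base vertex. All points of an orbit lie on one
  sphere, so \<open>conv (W a) = conv (W b)\<close> forces \<open>b \<in> W a\<close>, and it remains to see that an orbit meets
  a chamber at most once (\<open>same_side_orbit_unique\<close>).

  This last fact is obtained by rewriting rather than from simple roots and the length function.
  Fix \<open>c\<close> in the chamber and call a reflection step \<open>x \<rightarrow> s x\<close> in a root hyperplane an ascent if it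
  crosses to the side of \<open>c\<close>; then it increases \<open>x \<bullet> c\<close>. On a finite orbit off the
  hyperplanes, ascents terminate, and they get stuck exactly at the orbit points in the chamber of \<open>c\<close>. Any two points of
  the orbit are linked by reflections, each of which is an ascent in one of its two directions, so
  the claim is that ascents are confluent (\<open>ascent_confluent\<close>). By Newman's argument it suffices to
  join two ascents by reflections \<open>s\<close> and \<open>t\<close> from a common point. Continuing each of them by ascents in
  the roots of the dihedral group generated by \<open>s\<close> and \<open>t\<close>, one reaches two points \<open>y\<close> and \<open>z\<close> of one
  dihedral orbit in one dihedral chamber, which must coincide (\<open>dihedral_same_side_unique\<close>).
  Indeed, a dihedral element that takes \<open>y\<close> to \<open>z\<close> is trivial, or a reflection in a root,
  or a product of two such. A reflection in a root moves every chamber. A product \<open>s\<^sub>\<delta> s\<^sub>\<gamma>\<close> that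
  preserves a chamber permutes the finitely many orbit points in it, hence fixes their sum \<open>p\<close>, which
  lies in the chamber too; but \<open>s\<^sub>\<gamma> p = s\<^sub>\<delta> p\<close> with \<open>p\<close> off both hyperplanes makes \<open>\<gamma>\<close> and \<open>\<delta>\<close> parallel,
  so the product is trivial.
\<close>

section \<open>Reflections and ascents\<close>

lemma linear_reflection: "linear (reflection \<alpha>)"
  unfolding reflection_def
  by (rule linearI) (simp_all add: inner_add_left algebra_simps add_divide_distrib)

lemma reflection_involution [simp]: "reflection \<alpha> (reflection \<alpha> x) = x"
  by (cases "\<alpha> = 0") (simp_all add: reflection_def inner_diff_left)

lemma reflection_inner: "reflection \<alpha> x \<bullet> y = x \<bullet> reflection \<alpha> y"
  by (simp add: reflection_def inner_diff_left inner_diff_right inner_commute)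

lemma reflection_inner_root: "reflection \<alpha> x \<bullet> \<alpha> = - (x \<bullet> \<alpha>)"
  by (cases "\<alpha> = 0") (simp_all add: reflection_def inner_diff_left)

lemma orthogonal_transformation_reflection: "orthogonal_transformation (reflection \<alpha>)"
  unfolding orthogonal_transformation_def
  using linear_reflection by (simp add: reflection_inner)

text \<open>
  Orthogonal maps conjugate reflections to reflections. Read from right to left: the conjugate of a
  reflection in a root by another one is again the reflection in a root.
\<close>

lemma reflection_reflection:
  "reflection (reflection \<alpha> \<gamma>) x = reflection \<alpha> (reflection \<gamma> (reflection \<alpha> x))"
proof -
  have "reflection \<alpha> (reflection \<gamma> (reflection \<alpha> x)) =
      reflection \<alpha> (reflection \<alpha> x) - (2 * (reflection \<alpha> x \<bullet> \<gamma>) / (\<gamma> \<bullet> \<gamma>)) *\<^sub>R reflection \<alpha> \<gamma>"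
    unfolding reflection_def[of \<gamma>]
    by (simp add: linear_diff linear_reflection linear_cmul)
  then show ?thesis
    by (simp add: reflection_def[of "reflection \<alpha> \<gamma>"] reflection_inner)
qed

lemma reflection_eq_if_parallel:
  assumes "r \<noteq> 0" "s \<noteq> 0" "r *\<^sub>R \<gamma> = s *\<^sub>R \<delta>"
  shows "reflection \<gamma> = reflection \<delta>"
proof -
  have "\<gamma> = (s / r) *\<^sub>R \<delta>"
    using assms by (metis divideR_right scaleR_scaleR divide_inverse mult.commute)
  then show ?thesis
    using assms by (auto simp: reflection_def fun_eq_iff)
qed

definition reflection_step :: "(real ^ 'n) set \<Rightarrow> (real ^ 'n) rel" where
  "reflection_step \<Psi> = {(x, reflection \<gamma> x) | x \<gamma>. \<gamma> \<in> \<Psi>}"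

definition ascent :: "(real ^ 'n) set \<Rightarrow> real ^ 'n \<Rightarrow> (real ^ 'n) rel" where
  "ascent \<Psi> c = {(x, reflection \<gamma> x) | x \<gamma>. \<gamma> \<in> \<Psi> \<and> (x \<bullet> \<gamma>) * (c \<bullet> \<gamma>) < 0}"

text \<open>
  The cell of \<open>c\<close> in the arrangement of the hyperplanes orthogonal to \<open>\<Psi>\<close>. Comparing signs with \<open>c\<close>
  takes the place of a positive system. If \<open>c\<close> lies on one of the hyperplanes, the set is empty.
\<close>

definition same_side :: "(real ^ 'n) set \<Rightarrow> real ^ 'n \<Rightarrow> (real ^ 'n) set" where
  "same_side \<Psi> c = {x. \<forall>\<gamma>\<in>\<Psi>. (x \<bullet> \<gamma>) * (c \<bullet> \<gamma>) > 0}"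

lemma convex_same_side:
  fixes \<Psi> :: "(real ^ 'n) set"
  shows "convex (same_side \<Psi> c)"
proof -
  have "convex {x. (x \<bullet> \<gamma>) * (c \<bullet> \<gamma>) > 0}" for \<gamma> :: "real ^ 'n"
  proof -
    have "{x. (x \<bullet> \<gamma>) * (c \<bullet> \<gamma>) > 0} = {x. ((c \<bullet> \<gamma>) *\<^sub>R \<gamma>) \<bullet> x > 0}"
      by (simp add: inner_commute mult.commute)
    then show ?thesis
      using convex_halfspace_gt[of 0 "(c \<bullet> \<gamma>) *\<^sub>R \<gamma>"] by (simp only:)
  qed
  moreover have "same_side \<Psi> c = (\<Inter>\<gamma>\<in>\<Psi>. {x. (x \<bullet> \<gamma>) * (c \<bullet> \<gamma>) > 0})"
    by (auto simp: same_side_def)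
  ultimately show ?thesis
    by (auto intro: convex_INT)
qed

lemma ascent_subset_step: "ascent \<Psi> c \<subseteq> reflection_step \<Psi>"
  by (auto simp: ascent_def reflection_step_def)

lemma ascent_mono: "\<Psi> \<subseteq> \<Psi>' \<Longrightarrow> ascent \<Psi> c \<subseteq> ascent \<Psi>' c"
  by (auto simp: ascent_def)

lemma ascent_rtrancl_subset_step: "(ascent \<Psi> c)\<^sup>* \<subseteq> (reflection_step \<Psi>)\<^sup>*"
  by (rule rtrancl_mono[OF ascent_subset_step])

lemma sym_reflection_step: "sym (reflection_step \<Psi>)"
  by (force simp: sym_def reflection_step_def)

lemma ascent_increases:
  assumes "(x, y) \<in> ascent \<Psi> c"
  shows "x \<bullet> c < y \<bullet> c"
proof -
  obtain \<gamma> where y: "y = reflection \<gamma> x" and neg: "(x \<bullet> \<gamma>) * (c \<bullet> \<gamma>) < 0"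
    using assms by (auto simp: ascent_def)
  have "\<gamma> \<noteq> 0" using neg by auto
  then have "2 * ((x \<bullet> \<gamma>) * (c \<bullet> \<gamma>)) / (\<gamma> \<bullet> \<gamma>) < 0"
    using neg by (intro divide_neg_pos) (simp_all only: mult_less_0_iff inner_gt_zero_iff, auto)
  moreover have "y \<bullet> c = x \<bullet> c - 2 * ((x \<bullet> \<gamma>) * (c \<bullet> \<gamma>)) / (\<gamma> \<bullet> \<gamma>)"
    by (simp add: y reflection_def inner_diff_left inner_commute[of c])
  ultimately show ?thesis by simp
qed

lemma step_closed_rtrancl:
  assumes "\<And>x \<gamma>. x \<in> T \<Longrightarrow> \<gamma> \<in> \<Psi> \<Longrightarrow> reflection \<gamma> x \<in> T"
    and "(x, y) \<in> (reflection_step \<Psi>)\<^sup>*" and "x \<in> T"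
  shows "y \<in> T"
  using assms(2,3)
  by (induction rule: rtrancl_induct) (auto simp: reflection_step_def assms(1))

text \<open>
  Among the finitely many points reachable by ascents, one that maximizes the inner product with \<open>c\<close>
  admits no further ascent, and at a point off all hyperplanes this means lying on the side of \<open>c\<close>
  everywhere.
\<close>

lemma ascends_to_same_side:
  assumes fin: "finite T"
    and closed: "\<And>x \<gamma>. x \<in> T \<Longrightarrow> \<gamma> \<in> \<Psi> \<Longrightarrow> reflection \<gamma> x \<in> T"
    and reg: "\<And>x \<gamma>. x \<in> T \<Longrightarrow> \<gamma> \<in> \<Psi> \<Longrightarrow> x \<bullet> \<gamma> \<noteq> 0"
    and c: "\<And>\<gamma>. \<gamma> \<in> \<Psi> \<Longrightarrow> c \<bullet> \<gamma> \<noteq> 0"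
    and x: "x \<in> T"
  obtains y where "(x, y) \<in> (ascent \<Psi> c)\<^sup>*" "y \<in> T" "y \<in> same_side \<Psi> c"
proof -
  let ?A = "{y. (x, y) \<in> (ascent \<Psi> c)\<^sup>*}"
  have sub: "?A \<subseteq> T"
    using step_closed_rtrancl[OF closed _ x] ascent_rtrancl_subset_step by blast
  then have finA: "finite ?A" using fin finite_subset by blast
  have "?A \<noteq> {}" by blast
  obtain y where y: "y \<in> ?A" and max: "\<And>z. z \<in> ?A \<Longrightarrow> z \<bullet> c \<le> y \<bullet> c"
  proof -
    have "Max ((\<lambda>z. z \<bullet> c) ` ?A) \<in> (\<lambda>z. z \<bullet> c) ` ?A"
      using finA \<open>?A \<noteq> {}\<close> by (intro Max_in) auto
    then obtain y where "y \<in> ?A" "y \<bullet> c = Max ((\<lambda>z. z \<bullet> c) ` ?A)"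
      by (elim imageE) simp
    then show ?thesis using that[of y] finA by simp
  qed
  have "(y \<bullet> \<gamma>) * (c \<bullet> \<gamma>) > 0" if g: "\<gamma> \<in> \<Psi>" for \<gamma>
  proof (rule ccontr)
    assume "\<not> ?thesis"
    then have "(y \<bullet> \<gamma>) * (c \<bullet> \<gamma>) < 0"
      using reg[of y \<gamma>] c[OF g] sub y g by (auto simp: not_less le_less)
    then have step: "(y, reflection \<gamma> y) \<in> ascent \<Psi> c"
      using g by (auto simp: ascent_def)
    with y have "reflection \<gamma> y \<in> ?A" by (auto intro: rtrancl.rtrancl_into_rtrancl)
    from max[OF this] ascent_increases[OF step] show False by simp
  qed
  then show ?thesis
    using that[of y] y sub by (auto simp: same_side_def)
qed

section \<open>Dihedral subgroups\<close>

text \<open>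
  The images of \<open>\<alpha>\<close> and \<open>\<beta>\<close> under the group generated by their two reflections. Inside a larger root system these may be fewer than the roots in the plane of \<open>\<alpha>\<close> and
  \<open>\<beta>\<close>, but they suffice to join two ascents.
\<close>

inductive_set dihedral_roots :: "real ^ 'n \<Rightarrow> real ^ 'n \<Rightarrow> (real ^ 'n) set" for \<alpha> \<beta> where
  first: "\<alpha> \<in> dihedral_roots \<alpha> \<beta>"
| second: "\<beta> \<in> dihedral_roots \<alpha> \<beta>"
| reflect_first: "\<gamma> \<in> dihedral_roots \<alpha> \<beta> \<Longrightarrow> reflection \<alpha> \<gamma> \<in> dihedral_roots \<alpha> \<beta>"
| reflect_second: "\<gamma> \<in> dihedral_roots \<alpha> \<beta> \<Longrightarrow> reflection \<beta> \<gamma> \<in> dihedral_roots \<alpha> \<beta>"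

lemma dihedral_roots_commute_subset: "dihedral_roots \<alpha> \<beta> \<subseteq> dihedral_roots \<beta> \<alpha>"
proof
  fix \<gamma> assume "\<gamma> \<in> dihedral_roots \<alpha> \<beta>"
  then show "\<gamma> \<in> dihedral_roots \<beta> \<alpha>"
    by induction (auto intro: dihedral_roots.intros)
qed

lemma dihedral_roots_commute: "dihedral_roots \<alpha> \<beta> = dihedral_roots \<beta> \<alpha>"
  using dihedral_roots_commute_subset by blast

lemma dihedral_roots_closed:
  assumes "\<gamma> \<in> dihedral_roots \<alpha> \<beta>" "\<delta> \<in> dihedral_roots \<alpha> \<beta>"
  shows "reflection \<gamma> \<delta> \<in> dihedral_roots \<alpha> \<beta>"
  using assms
  by (induction arbitrary: \<delta>) (auto simp: reflection_reflection intro: dihedral_roots.intros)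

lemma dihedral_roots_subset:
  assumes "\<alpha> \<in> \<Phi>" "\<beta> \<in> \<Phi>" "\<And>\<gamma> \<delta>. \<gamma> \<in> \<Phi> \<Longrightarrow> \<delta> \<in> \<Phi> \<Longrightarrow> reflection \<gamma> \<delta> \<in> \<Phi>"
  shows "dihedral_roots \<alpha> \<beta> \<subseteq> \<Phi>"
proof
  fix \<gamma> assume "\<gamma> \<in> dihedral_roots \<alpha> \<beta>"
  then show "\<gamma> \<in> \<Phi>"
    by induction (auto intro: assms)
qed

text \<open>
  The word \<open>s\<^sub>\<alpha> s\<^sub>\<beta> s\<^sub>\<alpha> \<dots>\<close> with \<open>n\<close> letters. As both letters are involutions, these words together
  with those that start in \<open>\<beta>\<close> exhaust the dihedral group.
\<close>

fun alternating :: "nat \<Rightarrow> real ^ 'n \<Rightarrow> real ^ 'n \<Rightarrow> real ^ 'n \<Rightarrow> real ^ 'n" where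
  "alternating 0 \<alpha> \<beta> x = x"
| "alternating (Suc n) \<alpha> \<beta> x = reflection \<alpha> (alternating n \<beta> \<alpha> x)"

lemma alternating_snoc:
  "alternating (Suc n) \<alpha> \<beta> x = alternating n \<alpha> \<beta> (reflection (if even n then \<alpha> else \<beta>) x)"
proof (induction n arbitrary: \<alpha> \<beta>)
  case (Suc n)
  show ?case
    unfolding alternating.simps(2)[of "Suc n"] Suc by simp
qed simp

text \<open>
  An alternating word of odd length is a palindrome, so it is conjugate to its middle letter.
\<close>

lemma alternating_odd:
  "\<exists>\<gamma>\<in>dihedral_roots \<alpha> \<beta>. \<forall>x. alternating (Suc (2 * k)) \<alpha> \<beta> x = reflection \<gamma> x"
proof (induction k arbitrary: \<alpha> \<beta>)
  case 0
  show ?case by (auto intro: dihedral_roots.first)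
next
  case (Suc k)
  obtain \<gamma> where g: "\<gamma> \<in> dihedral_roots \<beta> \<alpha>"
      "\<And>x. alternating (Suc (2 * k)) \<beta> \<alpha> x = reflection \<gamma> x"
    using Suc by blast
  have "alternating (Suc (2 * Suc k)) \<alpha> \<beta> x = reflection (reflection \<alpha> \<gamma>) x" for x
  proof -
    have "alternating (Suc (2 * Suc k)) \<alpha> \<beta> x = reflection \<alpha> (alternating (Suc (Suc (2 * k))) \<beta> \<alpha> x)"
      by simp
    also have "\<dots> = reflection \<alpha> (alternating (Suc (2 * k)) \<beta> \<alpha> (reflection \<alpha> x))"
      unfolding alternating_snoc[of "Suc (2 * k)"] by simp
    finally show ?thesis
      unfolding g by (simp add: reflection_reflection)
  qed
  moreover have "reflection \<alpha> \<gamma> \<in> dihedral_roots \<alpha> \<beta>"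
    using g(1) dihedral_roots_commute dihedral_roots.reflect_first by blast
  ultimately show ?case by blast
qed

definition dihedral_words :: "real ^ 'n \<Rightarrow> real ^ 'n \<Rightarrow> (real ^ 'n \<Rightarrow> real ^ 'n) set" where
  "dihedral_words \<alpha> \<beta> = {alternating n \<alpha> \<beta> | n. True} \<union> {alternating n \<beta> \<alpha> | n. True}"

lemma dihedral_words_commute: "dihedral_words \<alpha> \<beta> = dihedral_words \<beta> \<alpha>"
  by (auto simp: dihedral_words_def)

lemma dihedral_words_reflect_first:
  assumes "d \<in> dihedral_words \<alpha> \<beta>"
  shows "(\<lambda>x. reflection \<alpha> (d x)) \<in> dihedral_words \<alpha> \<beta>"
proof -
  obtain n where "d = alternating n \<alpha> \<beta> \<or> d = alternating n \<beta> \<alpha>"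
    using assms by (auto simp: dihedral_words_def)
  \<comment> \<open>A new letter \<open>\<alpha>\<close> either lengthens the word or cancels its first letter. The empty word counts
    as starting in \<open>\<beta>\<close>.\<close>
  then consider "d = alternating n \<beta> \<alpha>" | m where "d = alternating (Suc m) \<alpha> \<beta>"
    by (cases n) (auto simp: fun_eq_iff)
  then have "\<exists>m. (\<lambda>x. reflection \<alpha> (d x)) = alternating m \<alpha> \<beta> \<or>
      (\<lambda>x. reflection \<alpha> (d x)) = alternating m \<beta> \<alpha>"
  proof cases
    case 1
    then have "(\<lambda>x. reflection \<alpha> (d x)) = alternating (Suc n) \<alpha> \<beta>" by auto
    then show ?thesis by blast
  next
    case (2 m)
    then have "(\<lambda>x. reflection \<alpha> (d x)) = alternating m \<beta> \<alpha>" by auto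
    then show ?thesis by blast
  qed
  then show ?thesis by (auto simp: dihedral_words_def)
qed

lemma dihedral_words_reflect:
  assumes "\<gamma> \<in> dihedral_roots \<alpha> \<beta>" "d \<in> dihedral_words \<alpha> \<beta>"
  shows "(\<lambda>x. reflection \<gamma> (d x)) \<in> dihedral_words \<alpha> \<beta>"
proof -
  have second: "(\<lambda>x. reflection \<beta> (d x)) \<in> dihedral_words \<alpha> \<beta>"
    if "d \<in> dihedral_words \<alpha> \<beta>" for d
    using that dihedral_words_reflect_first dihedral_words_commute by metis
  show ?thesis
    using assms
    by (induction arbitrary: d)
      (simp_all add: reflection_reflection second dihedral_words_reflect_first)
qed

text \<open>
  Odd words are reflections in dihedral roots; an even nonempty word is its first letter followed by
  an odd word, hence a product of two reflections in dihedral roots.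
\<close>

lemma dihedral_orbit_cases:
  assumes "(x, y) \<in> (reflection_step (dihedral_roots \<alpha> \<beta>))\<^sup>*"
  obtains "y = x"
    | \<gamma> where "\<gamma> \<in> dihedral_roots \<alpha> \<beta>" "y = reflection \<gamma> x"
    | \<gamma> \<delta> where "\<gamma> \<in> dihedral_roots \<alpha> \<beta>" "\<delta> \<in> dihedral_roots \<alpha> \<beta>"
        "y = reflection \<delta> (reflection \<gamma> x)"
proof -
  have "\<exists>d\<in>dihedral_words \<alpha> \<beta>. y = d x"
    using assms
  proof (induction rule: rtrancl_induct)
    case base
    have "alternating 0 \<alpha> \<beta> \<in> dihedral_words \<alpha> \<beta>" by (auto simp: dihedral_words_def)
    then show ?case by (metis alternating.simps(1))
  next
    case (step y z)
    then obtain d \<gamma> where "d \<in> dihedral_words \<alpha> \<beta>" "y = d x"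
        "\<gamma> \<in> dihedral_roots \<alpha> \<beta>" "z = reflection \<gamma> y"
      by (auto simp: reflection_step_def)
    then show ?case
      by (metis dihedral_words_reflect)
  qed
  then obtain n \<alpha>' \<beta>' where
      ab: "(\<alpha>', \<beta>') = (\<alpha>, \<beta>) \<or> (\<alpha>', \<beta>') = (\<beta>, \<alpha>)" and y: "y = alternating n \<alpha>' \<beta>' x"
    by (auto simp: dihedral_words_def)
  have roots: "dihedral_roots \<alpha>' \<beta>' = dihedral_roots \<alpha> \<beta>" "dihedral_roots \<beta>' \<alpha>' = dihedral_roots \<alpha> \<beta>"
    using ab dihedral_roots_commute[of \<alpha> \<beta>] by auto
  show ?thesis
  proof (cases n)
    case 0
    then show ?thesis using y that(1) by simp
  next
    case (Suc m)
    show ?thesis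
    proof (cases "even m")
      case True
      then obtain k where "m = 2 * k" by blast
      then show ?thesis
        using alternating_odd[of \<alpha>' \<beta>' k] that(2) y Suc roots by metis
    next
      case False
      then obtain k where k: "m = Suc (2 * k)" by (metis oddE Suc_eq_plus1)
      obtain \<gamma> where "\<gamma> \<in> dihedral_roots \<alpha> \<beta>" "alternating m \<beta>' \<alpha>' x = reflection \<gamma> x"
        using alternating_odd[of \<beta>' \<alpha>' k] k roots by metis
      then show ?thesis
        using that(3)[of \<gamma> \<alpha>'] y Suc roots dihedral_roots.first[of \<alpha>' \<beta>'] by auto
    qed
  qed
qed

text \<open>
  The product \<open>r\<close> of the two reflections maps the cell of \<open>c\<close> into itself, because \<open>r y\<close> and \<open>y\<close>
  lie in it and the adjoint of \<open>r\<close> maps \<open>\<Psi>\<close> into itself. It therefore permutes the finitely many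
  points of \<open>T\<close> in the cell and fixes their sum, a point of the cell. A product of reflections in
  two hyperplanes can fix a point off both of them only if the hyperplanes coincide.
\<close>

lemma rotation_preserving_chamber_trivial:
  assumes fin: "finite T"
    and closed: "\<And>x \<epsilon>. x \<in> T \<Longrightarrow> \<epsilon> \<in> \<Psi> \<Longrightarrow> reflection \<epsilon> x \<in> T"
    and roots: "\<And>\<epsilon> \<epsilon>'. \<epsilon> \<in> \<Psi> \<Longrightarrow> \<epsilon>' \<in> \<Psi> \<Longrightarrow> reflection \<epsilon> \<epsilon>' \<in> \<Psi>"
    and gd: "\<gamma> \<in> \<Psi>" "\<delta> \<in> \<Psi>"
    and y: "y \<in> T" "y \<in> same_side \<Psi> c"
    and ry: "reflection \<delta> (reflection \<gamma> y) \<in> same_side \<Psi> c"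
  shows "reflection \<delta> (reflection \<gamma> y) = y"
proof -
  define r where "r x = reflection \<delta> (reflection \<gamma> x)" for x
  have r_inner: "r x \<bullet> \<epsilon> = x \<bullet> reflection \<gamma> (reflection \<delta> \<epsilon>)" for x \<epsilon>
    by (simp add: r_def reflection_inner)
  define S where "S = T \<inter> same_side \<Psi> c"
  define p where "p = \<Sum>S"
  have "finite S" "y \<in> S" using fin y by (auto simp: S_def)
  have r_S: "r z \<in> S" if z: "z \<in> S" for z
  proof -
    have "(r z \<bullet> \<epsilon>) * (c \<bullet> \<epsilon>) > 0" if e: "\<epsilon> \<in> \<Psi>" for \<epsilon>
    proof -
      let ?e = "reflection \<gamma> (reflection \<delta> \<epsilon>)"
      have "?e \<in> \<Psi>" using roots gd e by blast
      then have "(z \<bullet> ?e) * (c \<bullet> ?e) > 0" "(y \<bullet> ?e) * (c \<bullet> ?e) > 0"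
        using z y by (auto simp: S_def same_side_def)
      moreover have "(y \<bullet> ?e) * (c \<bullet> \<epsilon>) > 0"
        using ry e by (simp add: same_side_def flip: r_def r_inner)
      ultimately show ?thesis
        unfolding r_inner by (auto simp: zero_less_mult_iff)
    qed
    then show ?thesis
      using z closed gd by (auto simp: S_def same_side_def r_def)
  qed
  have "inj r"
    by (rule injI) (metis r_def reflection_involution)
  then have img: "r ` S = S"
    using r_S \<open>finite S\<close> by (meson endo_inj_surj image_subsetI inj_on_subset subset_UNIV)
  have "linear r"
    unfolding r_def by (rule linear_compose[unfolded o_def, OF linear_reflection linear_reflection])
  have "r p = (\<Sum>x\<in>S. r x)"
    unfolding p_def by (simp add: linear_sum[OF \<open>linear r\<close>])
  also have "\<dots> = p"
    unfolding p_def using sum.reindex[of r S "\<lambda>x. x"] img \<open>inj r\<close> inj_on_subset by fastforce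
  finally have fixed: "r p = p" .
  have p: "(p \<bullet> \<epsilon>) * (c \<bullet> \<epsilon>) > 0" if "\<epsilon> \<in> \<Psi>" for \<epsilon>
  proof -
    have "(p \<bullet> \<epsilon>) * (c \<bullet> \<epsilon>) = (\<Sum>x\<in>S. (x \<bullet> \<epsilon>) * (c \<bullet> \<epsilon>))"
      by (simp add: p_def inner_sum_left sum_distrib_right)
    also have "\<dots> > 0"
      using \<open>finite S\<close> \<open>y \<in> S\<close> that by (intro sum_pos) (auto simp: S_def same_side_def)
    finally show ?thesis .
  qed
  have "p \<bullet> \<gamma> \<noteq> 0" "p \<bullet> \<delta> \<noteq> 0" using p gd by fastforce+
  then have nz: "2 * (p \<bullet> \<gamma>) / (\<gamma> \<bullet> \<gamma>) \<noteq> 0" "2 * (p \<bullet> \<delta>) / (\<delta> \<bullet> \<delta>) \<noteq> 0"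
    by auto
  have "reflection \<gamma> p = reflection \<delta> p"
    using fixed by (metis r_def reflection_involution)
  then have "(2 * (p \<bullet> \<gamma>) / (\<gamma> \<bullet> \<gamma>)) *\<^sub>R \<gamma> = (2 * (p \<bullet> \<delta>) / (\<delta> \<bullet> \<delta>)) *\<^sub>R \<delta>"
    by (simp add: reflection_def)
  then have "reflection \<gamma> = reflection \<delta>"
    using reflection_eq_if_parallel nz by blast
  then show ?thesis by simp
qed

text \<open>
  By \<open>dihedral_orbit_cases\<close> there are only two nontrivial ways to get from \<open>y\<close> to \<open>z\<close>: a reflection,
  which would take \<open>y\<close> to the wrong side of its own hyperplane, and a rotation, which
  \<open>rotation_preserving_chamber_trivial\<close> shows to fix \<open>y\<close>. This is local confluence for ascents.
\<close>

lemma dihedral_same_side_unique: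
  assumes fin: "finite T"
    and closed: "\<And>x \<gamma>. x \<in> T \<Longrightarrow> \<gamma> \<in> dihedral_roots \<alpha> \<beta> \<Longrightarrow> reflection \<gamma> x \<in> T"
    and y: "y \<in> T" "y \<in> same_side (dihedral_roots \<alpha> \<beta>) c"
    and z: "z \<in> same_side (dihedral_roots \<alpha> \<beta>) c"
    and yz: "(y, z) \<in> (reflection_step (dihedral_roots \<alpha> \<beta>))\<^sup>*"
  shows "y = z"
  using yz
proof (cases rule: dihedral_orbit_cases)
  case 1
  then show ?thesis by simp
next
  case (2 \<gamma>)
  then have "(y \<bullet> \<gamma>) * (c \<bullet> \<gamma>) > 0" "- (y \<bullet> \<gamma>) * (c \<bullet> \<gamma>) > 0"
    using y z by (auto simp: same_side_def simp flip: reflection_inner_root)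
  then show ?thesis by simp
next
  case (3 \<gamma> \<delta>)
  then show ?thesis
    using rotation_preserving_chamber_trivial[of T "dihedral_roots \<alpha> \<beta>" \<gamma> \<delta> y c]
      fin closed dihedral_roots_closed y z by metis
qed

section \<open>An orbit meets a chamber at most once\<close>

text \<open>
  Newman's argument: induction on the number of orbit points that are higher than \<open>x\<close> in direction
  \<open>c\<close>. The first steps \<open>u\<close> and \<open>v\<close> of two chains of ascents are joined at a point \<open>m\<close> inside
  their dihedral orbit; a further chain from \<open>m\<close> ends at some \<open>n\<close>, and the induction hypothesis at
  \<open>u\<close> and at \<open>v\<close> identifies both given endpoints with \<open>n\<close>.
\<close>

lemma ascent_confluent:
  assumes fin: "finite T"
    and closed: "\<And>x \<gamma>. x \<in> T \<Longrightarrow> \<gamma> \<in> \<Phi> \<Longrightarrow> reflection \<gamma> x \<in> T"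
    and roots: "\<And>\<gamma> \<delta>. \<gamma> \<in> \<Phi> \<Longrightarrow> \<delta> \<in> \<Phi> \<Longrightarrow> reflection \<gamma> \<delta> \<in> \<Phi>"
    and reg: "\<And>x \<gamma>. x \<in> T \<Longrightarrow> \<gamma> \<in> \<Phi> \<Longrightarrow> x \<bullet> \<gamma> \<noteq> 0"
    and c: "\<And>\<gamma>. \<gamma> \<in> \<Phi> \<Longrightarrow> c \<bullet> \<gamma> \<noteq> 0"
    and "x \<in> T" "(x, y) \<in> (ascent \<Phi> c)\<^sup>*" "(x, z) \<in> (ascent \<Phi> c)\<^sup>*"
    and "y \<in> same_side \<Phi> c" "z \<in> same_side \<Phi> c"
  shows "y = z"
  using assms(6-)
proof (induction "card {t \<in> T. x \<bullet> c < t \<bullet> c}" arbitrary: x y z rule: less_induct)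
  case less
  have no_ascent: "(s, t) \<notin> ascent \<Phi> c" if "s \<in> same_side \<Phi> c" for s t
    using that by (force simp: ascent_def same_side_def)
  show ?case
  proof (cases "x = y \<or> x = z")
    case True
    then show ?thesis
      using less.prems no_ascent by (metis converse_rtranclE)
  next
    case False
    then obtain u v where u: "(x, u) \<in> ascent \<Phi> c" "(u, y) \<in> (ascent \<Phi> c)\<^sup>*"
      and v: "(x, v) \<in> ascent \<Phi> c" "(v, z) \<in> (ascent \<Phi> c)\<^sup>*"
      using less.prems by (metis converse_rtranclE)
    obtain \<alpha> \<beta> where ab: "\<alpha> \<in> \<Phi>" "\<beta> \<in> \<Phi>" "u = reflection \<alpha> x" "v = reflection \<beta> x"
      using u v by (auto simp: ascent_def)
    have T: "u \<in> T" "v \<in> T" using ab closed less.prems(1) by auto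
    have smaller: "card {t \<in> T. w \<bullet> c < t \<bullet> c} < card {t \<in> T. x \<bullet> c < t \<bullet> c}"
      if "(x, w) \<in> ascent \<Phi> c" "w \<in> T" for w
      using ascent_increases[OF that(1)] that(2) fin by (intro psubset_card_mono) auto
    let ?\<Psi> = "dihedral_roots \<alpha> \<beta>"
    have sub: "?\<Psi> \<subseteq> \<Phi>" using dihedral_roots_subset ab roots by blast
    obtain m where m: "(u, m) \<in> (ascent ?\<Psi> c)\<^sup>*" "m \<in> T" "m \<in> same_side ?\<Psi> c"
      using ascends_to_same_side[of T ?\<Psi> c u] fin closed reg c sub T by blast
    obtain m' where m': "(v, m') \<in> (ascent ?\<Psi> c)\<^sup>*" "m' \<in> T" "m' \<in> same_side ?\<Psi> c"
      using ascends_to_same_side[of T ?\<Psi> c v] fin closed reg c sub T by blast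
    have "(u, x) \<in> reflection_step ?\<Psi>" "(x, v) \<in> reflection_step ?\<Psi>"
      using ab sym_reflection_step[of ?\<Psi>] dihedral_roots.first[of \<alpha> \<beta>]
        dihedral_roots.second[of \<beta> \<alpha>]
      by (auto simp: reflection_step_def sym_def)
    moreover have "(m, u) \<in> (reflection_step ?\<Psi>)\<^sup>*" "(v, m') \<in> (reflection_step ?\<Psi>)\<^sup>*"
      using m(1) m'(1) ascent_rtrancl_subset_step sym_rtrancl[OF sym_reflection_step]
      by (metis symD subsetD)+
    ultimately have "(m, m') \<in> (reflection_step ?\<Psi>)\<^sup>*"
      by (meson rtrancl.rtrancl_into_rtrancl rtrancl_trans)
    then have "m = m'"
      using dihedral_same_side_unique[of T \<alpha> \<beta> m c m'] fin closed sub m m' by blast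
    obtain n where n: "(m, n) \<in> (ascent \<Phi> c)\<^sup>*" "n \<in> same_side \<Phi> c"
      by (rule ascends_to_same_side[OF fin closed reg c m(2)])
    have "(u, m) \<in> (ascent \<Phi> c)\<^sup>*" "(v, m) \<in> (ascent \<Phi> c)\<^sup>*"
      using m(1) m'(1) \<open>m = m'\<close> rtrancl_mono[OF ascent_mono[OF sub, of c]] by blast+
    then have "(u, n) \<in> (ascent \<Phi> c)\<^sup>*" "(v, n) \<in> (ascent \<Phi> c)\<^sup>*"
      using n(1) by (blast intro: rtrancl_trans)+
    then have "y = n" "z = n"
      using less.hyps[OF smaller[OF u(1) T(1)] T(1) u(2) _ less.prems(4) n(2)]
        less.hyps[OF smaller[OF v(1) T(2)] T(2) v(2) _ less.prems(5) n(2)] by simp_all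
    then show ?thesis by simp
  qed
qed

text \<open>
  Every point of the orbit ascends to \<open>a\<close>: walk from \<open>a\<close> along reflections and note that each step is
  an ascent forwards or backwards, so that confluence carries the property along. The point \<open>b\<close>
  admits no ascent at all, hence equals \<open>a\<close>.
\<close>

lemma same_side_orbit_unique:
  assumes fin: "finite {y. (a, y) \<in> (reflection_step \<Phi>)\<^sup>*}"
    and roots: "\<And>\<gamma> \<delta>. \<gamma> \<in> \<Phi> \<Longrightarrow> \<delta> \<in> \<Phi> \<Longrightarrow> reflection \<gamma> \<delta> \<in> \<Phi>"
    and a: "a \<in> same_side \<Phi> c" and b: "b \<in> same_side \<Phi> c"
    and ab: "(a, b) \<in> (reflection_step \<Phi>)\<^sup>*"
  shows "a = b"
proof -
  define T where "T = {y. (a, y) \<in> (reflection_step \<Phi>)\<^sup>*}"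
  have finT: "finite T" using fin by (simp add: T_def)
  have closed: "reflection \<gamma> x \<in> T" if "x \<in> T" "\<gamma> \<in> \<Phi>" for x \<gamma>
    using that unfolding T_def by (auto simp: reflection_step_def intro: rtrancl.rtrancl_into_rtrancl)
  have c: "c \<bullet> \<gamma> \<noteq> 0" if "\<gamma> \<in> \<Phi>" for \<gamma>
    using a that by (force simp: same_side_def)
  have reg: "x \<bullet> \<gamma> \<noteq> 0" if "x \<in> T" "\<gamma> \<in> \<Phi>" for x \<gamma>
  proof -
    have "\<forall>\<gamma>\<in>\<Phi>. x \<bullet> \<gamma> \<noteq> 0"
      using \<open>x \<in> T\<close> unfolding T_def mem_Collect_eq
    proof (induction rule: rtrancl_induct)
      case base
      then show ?case using a by (force simp: same_side_def)
    next
      case (step y z)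
      then show ?case by (auto simp: reflection_step_def reflection_inner roots)
    qed
    then show ?thesis using that by blast
  qed
  have "(x, a) \<in> (ascent \<Phi> c)\<^sup>*" if "(a, x) \<in> (reflection_step \<Phi>)\<^sup>*" for x
    using that
  proof (induction rule: rtrancl_induct)
    case (step x y)
    then obtain \<gamma> where g: "\<gamma> \<in> \<Phi>" "y = reflection \<gamma> x" by (auto simp: reflection_step_def)
    have xT: "x \<in> T" "y \<in> T" using step g closed by (auto simp: T_def)
    have xa: "(x, a) \<in> (ascent \<Phi> c)\<^sup>*" using step by blast
    show ?case
    proof (cases "(x \<bullet> \<gamma>) * (c \<bullet> \<gamma>) < 0")
      case True
      obtain n where n: "(y, n) \<in> (ascent \<Phi> c)\<^sup>*" "n \<in> same_side \<Phi> c"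
        by (rule ascends_to_same_side[OF finT closed reg c xT(2)])
      have "(x, y) \<in> ascent \<Phi> c" using True g by (auto simp: ascent_def)
      then have "(x, n) \<in> (ascent \<Phi> c)\<^sup>*" using n(1) by auto
      then have "n = a"
        using ascent_confluent[OF finT closed roots reg c xT(1) _ xa n(2) a] by simp
      then show ?thesis using n by blast
    next
      case False
      then have "(x \<bullet> \<gamma>) * (c \<bullet> \<gamma>) > 0"
        using reg[OF xT(1) g(1)] c[OF g(1)] by (meson linorder_neqE_linordered_idom mult_eq_0_iff)
      then have "(y, x) \<in> ascent \<Phi> c"
        using g by (force simp: ascent_def reflection_inner_root)
      then show ?thesis using xa by auto
    qed
  qed blast
  then have "(b, a) \<in> (ascent \<Phi> c)\<^sup>*" using ab by blast
  moreover have "(b, s) \<notin> ascent \<Phi> c" for s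
    using b by (force simp: ascent_def same_side_def)
  ultimately show ?thesis by (metis converse_rtranclE)
qed

section \<open>Reflection groups and chambers\<close>

lemma root_system_reflection_mem:
  assumes "root_system \<Phi>" "\<gamma> \<in> \<Phi>" "\<delta> \<in> \<Phi>"
  shows "reflection \<gamma> \<delta> \<in> \<Phi>"
  using assms by (auto simp: root_system_def)

lemma reflection_mem_Bij: "reflection \<alpha> \<in> Bij UNIV"
  by (simp add: Bij_def extensional_def bij_def inj_def surj_def)
    (metis reflection_involution)

lemma BijGroup_UNIV_one: "\<one>\<^bsub>BijGroup UNIV\<^esub> = (id :: 'a \<Rightarrow> 'a)"
  by (simp add: BijGroup_def fun_eq_iff)

lemma BijGroup_UNIV_mult:
  fixes v w :: "'a \<Rightarrow> 'a"
  assumes "v \<in> Bij UNIV" "w \<in> Bij UNIV"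
  shows "v \<otimes>\<^bsub>BijGroup UNIV\<^esub> w = v \<circ> w"
  using assms by (simp add: BijGroup_def compose_def fun_eq_iff)

lemma generate_reflections_mem_Bij:
  assumes "w \<in> generate (BijGroup UNIV) (reflection ` \<Phi>)"
  shows "w \<in> Bij UNIV"
proof -
  have "reflection ` \<Phi> \<subseteq> carrier (BijGroup UNIV)"
    using reflection_mem_Bij by (auto simp: BijGroup_def)
  then show ?thesis
    using group.generate_in_carrier[OF group_BijGroup _ assms] by (simp add: BijGroup_def)
qed

lemma inv_reflection:
  "inv\<^bsub>BijGroup UNIV\<^esub> (reflection \<alpha>) = reflection \<alpha>"
proof (rule group.inv_equality[OF group_BijGroup])
  show "reflection \<alpha> \<otimes>\<^bsub>BijGroup UNIV\<^esub> reflection \<alpha> = \<one>\<^bsub>BijGroup UNIV\<^esub>"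
    by (simp add: BijGroup_UNIV_mult BijGroup_UNIV_one reflection_mem_Bij fun_eq_iff)
qed (simp_all add: BijGroup_def reflection_mem_Bij)

text \<open>
  Induction over the group with plain composition and without a case for inverses: reflections are
  their own inverses.
\<close>

lemma generate_reflections_induct [consumes 1, case_names id reflection comp]:
  assumes "w \<in> generate (BijGroup UNIV) (reflection ` \<Phi>)"
    and "P id" "\<And>\<alpha>. \<alpha> \<in> \<Phi> \<Longrightarrow> P (reflection \<alpha>)"
    and "\<And>v w. P v \<Longrightarrow> P w \<Longrightarrow> P (v \<circ> w)"
  shows "P w"
  using assms(1)
proof (induction rule: generate.induct)
  case one
  show ?case unfolding BijGroup_UNIV_one by (rule assms(2))
next
  case (incl h)
  then show ?case using assms(3) by blast
next
  case (inv h)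
  then show ?case using assms(3) by (auto simp: inv_reflection)
next
  case (eng v w)
  then show ?case
    using assms(4) by (metis BijGroup_UNIV_mult generate_reflections_mem_Bij)
qed

lemma finite_reflection_group_id:
  "finite_reflection_group W \<Phi> \<Longrightarrow> id \<in> W"
  using generate.one[of "BijGroup UNIV" "reflection ` \<Phi>"]
  unfolding finite_reflection_group_def BijGroup_UNIV_one by blast

lemma finite_reflection_group_reflection_comp:
  assumes W: "finite_reflection_group W \<Phi>" and "\<alpha> \<in> \<Phi>" "w \<in> W"
  shows "reflection \<alpha> \<circ> w \<in> W"
proof -
  let ?G = "generate (BijGroup UNIV) (reflection ` \<Phi>)"
  have WG: "W = ?G" using W by (simp add: finite_reflection_group_def)
  have "reflection \<alpha> \<otimes>\<^bsub>BijGroup UNIV\<^esub> w \<in> ?G"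
    using assms(2,3) unfolding WG by (metis generate.eng generate.incl imageI)
  moreover have "w \<in> Bij UNIV"
    using generate_reflections_mem_Bij \<open>w \<in> W\<close> WG by blast
  ultimately show ?thesis
    by (simp only: WG BijGroup_UNIV_mult reflection_mem_Bij)
qed

lemma finite_reflection_group_base_mem_orbit:
  "finite_reflection_group W \<Phi> \<Longrightarrow> a \<in> (\<lambda>w. w a) ` W"
  using imageI[OF finite_reflection_group_id, of W \<Phi> "\<lambda>w. w a"] by simp

lemma finite_reflection_group_orthogonal:
  assumes "finite_reflection_group W \<Phi>" "w \<in> W"
  shows "orthogonal_transformation w"
proof -
  have "w \<in> generate (BijGroup UNIV) (reflection ` \<Phi>)"
    using assms by (simp add: finite_reflection_group_def)
  then show ?thesis
    by (induction rule: generate_reflections_induct)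
      (simp_all only: orthogonal_transformation_id[folded id_def]
        orthogonal_transformation_reflection orthogonal_transformation_compose)
qed

lemma finite_reflection_group_orbit:
  assumes W: "finite_reflection_group W \<Phi>"
  shows "(\<lambda>w. w a) ` W = {y. (a, y) \<in> (reflection_step \<Phi>)\<^sup>*}"
proof (intro equalityI subsetI)
  fix y assume "y \<in> (\<lambda>w. w a) ` W"
  then obtain w where w: "w \<in> generate (BijGroup UNIV) (reflection ` \<Phi>)" "y = w a"
    using W by (auto simp: finite_reflection_group_def)
  have "\<forall>x. (x, w x) \<in> (reflection_step \<Phi>)\<^sup>*"
    using w(1)
  proof (induction rule: generate_reflections_induct)
    case (comp v w)
    then show ?case by (metis comp_apply rtrancl_trans)
  qed (auto simp: reflection_step_def)
  then show "y \<in> {y. (a, y) \<in> (reflection_step \<Phi>)\<^sup>*}" using w(2) by simp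
next
  fix y assume "y \<in> {y. (a, y) \<in> (reflection_step \<Phi>)\<^sup>*}"
  then have "(a, y) \<in> (reflection_step \<Phi>)\<^sup>*" by simp
  then show "y \<in> (\<lambda>w. w a) ` W"
  proof (induction rule: rtrancl_induct)
    case base
    show ?case by (rule finite_reflection_group_base_mem_orbit[OF W])
  next
    case (step y z)
    then obtain w \<gamma> where "w \<in> W" "y = w a" "\<gamma> \<in> \<Phi>" "z = reflection \<gamma> y"
      by (auto simp: reflection_step_def)
    then show ?case
      using finite_reflection_group_reflection_comp[OF W, of \<gamma> w]
      by (intro image_eqI[where x = "reflection \<gamma> \<circ> w"]) simp_all
  qed
qed

text \<open>
  A connected set that avoids the hyperplanes cannot change sides, so a component lies in a cell of
  sign conditions; that cell is convex, hence connected, and thus contained in the component.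
\<close>

lemma chamber_eq_same_side:
  assumes B: "B \<in> chambers \<Phi>"
  obtains c where "B = same_side \<Phi> c"
proof -
  let ?U = "UNIV - (\<Union>\<alpha>\<in>\<Phi>. {x. x \<bullet> \<alpha> = 0})"
  have comp: "B \<in> components ?U" using B by (simp add: chambers_def)
  then obtain c where c: "c \<in> B" using in_components_nonempty by blast
  have sub: "B \<subseteq> ?U" using comp in_components_subset by blast
  have conn: "connected B" using comp in_components_connected by blast
  have c_reg: "c \<bullet> \<alpha> \<noteq> 0" if "\<alpha> \<in> \<Phi>" for \<alpha> using sub c that by auto
  have "B \<subseteq> same_side \<Phi> c"
  proof
    fix x assume x: "x \<in> B"
    have "(x \<bullet> \<alpha>) * (c \<bullet> \<alpha>) > 0" if a: "\<alpha> \<in> \<Phi>" for \<alpha>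
    proof (rule ccontr)
      assume "\<not> ?thesis"
      then have le: "(x \<bullet> \<alpha>) * (c \<bullet> \<alpha>) \<le> 0" by simp
      let ?f = "\<lambda>x. (x \<bullet> \<alpha>) * (c \<bullet> \<alpha>)"
      have "connected (?f ` B)"
        by (intro connected_continuous_image conn continuous_intros)
      moreover have "?f x \<in> ?f ` B" "?f c \<in> ?f ` B" using x c by auto
      moreover have "?f c \<ge> 0" by simp
      ultimately have "0 \<in> ?f ` B"
        using le unfolding connected_iff_interval by blast
      then show False using sub a c_reg[OF a] by auto
    qed
    then show "x \<in> same_side \<Phi> c" by (simp add: same_side_def)
  qed
  moreover have "same_side \<Phi> c \<subseteq> B"
  proof (rule components_maximal[OF comp])
    show "connected (same_side \<Phi> c)" by (rule convex_connected[OF convex_same_side])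
    show "same_side \<Phi> c \<subseteq> ?U" by (force simp: same_side_def)
    have "c \<in> same_side \<Phi> c"
      using c_reg by (simp add: same_side_def flip: power2_eq_square)
    then show "B \<inter> same_side \<Phi> c \<noteq> {}" using c by blast
  qed
  ultimately show ?thesis using that by blast
qed

section \<open>Orbit polytopes\<close>

text \<open>
  If \<open>b\<close> were not in \<open>S\<close>, then by the strict case of Cauchy-Schwarz the whole of \<open>S\<close>, and with it the convex hull,
  would lie strictly below the tangent hyperplane at \<open>b\<close> to the sphere through \<open>b\<close>.
\<close>

lemma max_norm_in_convex_hull_imp_mem:
  fixes b :: "'a :: real_inner"
  assumes b: "b \<in> convex hull S" and S: "\<And>x. x \<in> S \<Longrightarrow> norm x \<le> norm b"
  shows "b \<in> S"
proof (rule ccontr)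
  assume "b \<notin> S"
  have "x \<bullet> b < b \<bullet> b" if x: "x \<in> S" for x
  proof -
    have "0 < (x - b) \<bullet> (x - b)" using x \<open>b \<notin> S\<close> by auto
    also have "\<dots> = x \<bullet> x - 2 * (x \<bullet> b) + b \<bullet> b"
      by (simp add: inner_diff_left inner_diff_right inner_commute)
    finally show ?thesis
      using S[OF x] by (simp add: norm_le)
  qed
  then have "S \<subseteq> {x. b \<bullet> x < b \<bullet> b}" by (auto simp: inner_commute)
  then have "convex hull S \<subseteq> {x. b \<bullet> x < b \<bullet> b}"
    by (rule hull_minimal) (rule convex_halfspace_lt)
  with b show False by auto
qed

text \<open>
  The group preserves norms, so the two orbits lie on spheres about the origin; equal polytopes force
  equal radii, and the points of a convex hull on the circumscribed sphere are among the given ones.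
\<close>

lemma orbit_polytope_eqD:
  assumes W: "finite_reflection_group W \<Phi>" and eq: "orbit_polytope W a = orbit_polytope W b"
  shows "b \<in> (\<lambda>w. w a) ` W"
proof -
  have norm_w: "norm (w x) = norm x" if "w \<in> W" for w x
    using finite_reflection_group_orthogonal[OF W that] orthogonal_transformation_norm by blast
  have self: "x \<in> orbit_polytope W x" for x
    unfolding orbit_polytope_def
    by (rule hull_inc) (rule finite_reflection_group_base_mem_orbit[OF W])
  have bound: "orbit_polytope W x \<subseteq> cball 0 (norm x)" for x
    unfolding orbit_polytope_def by (rule hull_minimal) (auto simp: norm_w)
  have "norm a \<le> norm b"
    using self[of a] bound[of b] eq by auto
  then show ?thesis
    using self[of b] unfolding eq[symmetric]
    by (auto simp: orbit_polytope_def norm_w intro!: max_norm_in_convex_hull_imp_mem)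
qed

lemma inj_on_orbit_polytope:
  assumes W: "finite_reflection_group W \<Phi>" and B: "B \<in> chambers \<Phi>"
  shows "inj_on (orbit_polytope W) B"
proof (rule inj_onI)
  fix a b assume ab: "a \<in> B" "b \<in> B" "orbit_polytope W a = orbit_polytope W b"
  obtain c where c: "B = same_side \<Phi> c" using chamber_eq_same_side[OF B] .
  have "finite W" using W unfolding finite_reflection_group_def by blast
  then have orbit: "b \<in> {y. (a, y) \<in> (reflection_step \<Phi>)\<^sup>*}"
      "finite {y. (a, y) \<in> (reflection_step \<Phi>)\<^sup>*}"
    using orbit_polytope_eqD[OF W ab(3)]
    unfolding finite_reflection_group_orbit[OF W, symmetric] by simp_all
  have "root_system \<Phi>" using W by (simp add: finite_reflection_group_def)
  then show "a = b"
    using same_side_orbit_unique[OF orbit(2) root_system_reflection_mem] ab orbit(1) c by blast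
qed

lemma base_vertex_orbit_polytope:
  assumes "finite_reflection_group W \<Phi>" "B \<in> chambers \<Phi>" "a \<in> B"
  shows "base_vertex W B (orbit_polytope W a) = a"
  unfolding base_vertex_def
  using inj_on_orbit_polytope[OF assms(1,2)] assms(3) by (intro the_equality) (auto dest: inj_onD)

section \<open>The orbit realization space\<close>

text \<open>
  The vertex matrix of \<open>orbit_polytope (set ws) a\<close> depends linearly on \<open>a\<close> in the chamber, and its row for the identity, which
  comes first in \<open>ws\<close>, is \<open>a\<close> itself.
\<close>

lemma orbit_realization_space_homeomorphic_chamber:
  fixes \<Phi> B :: "(real ^ 'n) set"
  assumes W: "finite_reflection_group (set ws) \<Phi>" and B: "B \<in> chambers \<Phi>" and hd: "hd ws = id"
  shows "orbit_realization_space ws B homeomorphic_space top_of_set B"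
proof -
  let ?X = "orbit_realization_space ws B"
  let ?I = "{..<length ws} \<times> (UNIV :: 'n set)"
  let ?P = "orbit_polytope (set ws)" and ?v = "base_vertex (set ws) B"
  have "ws \<noteq> []" using finite_reflection_group_id[OF W] by auto
  then have row0: "0 < length ws" "ws ! 0 = id" using hd by (auto simp: hd_conv_nth)
  have v: "?v (?P a) = a" if "a \<in> B" for a
    using base_vertex_orbit_polytope[OF W B that] .
  have space: "topspace ?X = ?P ` B"
    by (auto simp: orbit_realization_space_def topspace_pullback_topology orbit_realizations_def
        vertex_matrix_def)
  have matrix: "continuous_map ?X (powertop_real ?I) (vertex_matrix ws B)"
    unfolding orbit_realization_space_def
    using continuous_map_pullback[OF continuous_map_id] by simp
  have entry: "continuous_map ?X euclideanreal (\<lambda>P. ?v P $ j)" for j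
  proof -
    have "continuous_map ?X euclideanreal (\<lambda>P. vertex_matrix ws B P (0, j))"
      using matrix row0 by (auto simp: continuous_map_componentwise)
    then show ?thesis
      using row0 by (simp add: vertex_matrix_def)
  qed
  have "continuous_map ?X euclidean ?v"
    using entry unfolding continuous_map_atin by (auto intro!: vec_tendstoI)
  then have to_chamber: "continuous_map ?X (top_of_set B) ?v"
    using v by (auto simp: continuous_map_in_subtopology space)
  have from_chamber: "continuous_map (top_of_set B) ?X ?P"
    unfolding orbit_realization_space_def
  proof (rule continuous_map_pullback')
    show "continuous_map (top_of_set B) (powertop_real ?I) (vertex_matrix ws B \<circ> ?P)"
      unfolding continuous_map_componentwise
    proof (intro conjI ballI)
      fix k assume k: "k \<in> ?I"
      obtain i j where ij: "k = (i, j)" "i < length ws" using k by auto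
      have "orthogonal_transformation (ws ! i)"
        using finite_reflection_group_orthogonal[OF W] ij(2) by simp
      then have "continuous_on B (ws ! i)"
        by (intro linear_continuous_on linear_linear[THEN iffD2]) (simp add: orthogonal_transformation_linear)
      then have "continuous_on B (\<lambda>a. (ws ! i) a $ j)" by (intro continuous_intros)
      moreover have "(vertex_matrix ws B \<circ> ?P) a k = (ws ! i) a $ j" if "a \<in> B" for a
        using that ij v by (simp add: vertex_matrix_def)
      ultimately show "continuous_map (top_of_set B) euclideanreal (\<lambda>a. (vertex_matrix ws B \<circ> ?P) a k)"
        by (simp cong: continuous_on_cong)
    qed (auto simp: vertex_matrix_def)
  qed (auto simp: orbit_realizations_def)
  have "homeomorphic_maps ?X (top_of_set B) ?v ?P"
    using to_chamber from_chamber v by (auto simp: homeomorphic_maps_def space)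
  then show ?thesis by (rule homeomorphic_maps_imp_homeomorphic_space)
qed

theorem corollary4p2:
  fixes W :: "(real ^ 'n \<Rightarrow> real ^ 'n) set"
    and \<Phi> B :: "(real ^ 'n) set"
    and ws :: "(real ^ 'n \<Rightarrow> real ^ 'n) list"
  assumes "finite_reflection_group W \<Phi>"
    and "B \<in> chambers \<Phi>"
    and "set ws = W" and "distinct ws" and "hd ws = id"
  shows "contractible_space (orbit_realization_space ws B) \<and>
         path_connected_space (orbit_realization_space ws B)"
proof -
  obtain c where "B = same_side \<Phi> c" using chamber_eq_same_side[OF assms(2)] .
  then have "contractible_space (top_of_set B)"
    by (simp add: contractible_space_top_of_set convex_imp_contractible convex_same_side)
  moreover have "orbit_realization_space ws B homeomorphic_space top_of_set B"
    using orbit_realization_space_homeomorphic_chamber assms by blast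
  ultimately have "contractible_space (orbit_realization_space ws B)"
    using homeomorphic_space_contractibility by blast
  then show ?thesis
    using contractible_imp_path_connected_space by blast
qed

end
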